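(* Let $K$ be a partition of $X$ parametrized by $(T,\mathcal A,\phi)$, let $d\in\mathcal D(X,\mathcal O)$ and let $\mu\in\mathcal M_P(X,\mathcal O)$. Assume that $d$ is adapted, that $g_d$ is thick, exponential and uniformly finite, and that $g_\mu$ is exponential. Then $\mu$ has the volume doubling property with respect to $d$ if and only if $g_d$ is gentle with respect to $g_\mu$ (written $g_d\sim_{GE}g_\mu$).
   Context: Setting. $T$ is a countably infinite set, $\mathcal A:T\times T\to\{0,1\}$ is symmetric and vanishes on the diagonal, the graph on $T$ with edges $\{(w,v):\mathcal A(w,v)=1\}$ is a locally finite tree, and $\phi\in T$ is a fixed root. For $w\in T$: $|w|$ is the tree distance from $\phi$ to $w$; $(T)_m=\{w:|w|=m\}$; $\pi(w)$ is the neighbour of $w$ on the geodesic from $\phi$ to $w$ ($\pi(\phi)=\phi$); $S(w)$ is the set of neighbours of $w$ other than $\pi(w)$; $T_w$ is the set of $v\in T$ such that $w$ lies on the geodesic from $\phi$ to $v$. $\Sigma$ is the set of infinite geodesic rays $\omega=([\omega]_0=\phi,[\omega]_1,\ldots)$ of the tree starting at $\phi$. $(X,\mathcal O)$ is a compact metrizable topological space with no isolated point. A partition $K$ of $X$ parametrized by $(T,\mathcal A,\phi)$ assigns to each $w\in T$ a nonempty compact set $K_w\subseteq X$ such that $K_\phi=X$, $K_w=\bigcup_{v\in S(w)}K_v$ for all $w$, and $\bigcap_{m\ge0}K_{[\omega]_m}$ is a single point for every $\omega\in\Sigma$. Weight functions. A weight function is $g:T\to(0,1]$ with $g(\phi)=1$,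 $g(\pi(w))\ge g(w)$ for all $w$, and $\lim_{m\to\infty}\sup_{w\in(T)_m}g(w)=0$. For $s\in(0,1)$, $\Lambda^g_s=\{w\in T: g(\pi(w))>s\ge g(w)\}$; for $s\ge1$, $\Lambda^g_s=\{\phi\}$. For an integer $M\ge0$, $x\in X$, $s>0$, $U^g_M(x,s)$ is the set of $y\in X$ for which there are $w(1),\ldots,w(M+1)\in\Lambda^g_s$ with $x\in K_{w(1)}$, $y\in K_{w(M+1)}$ and $K_{w(i)}\cap K_{w(i+1)}\ne\emptyset$ for $1\le i\le M$. A function $f:T\to(0,\infty)$ is sub-exponential if there are $m\ge0$, $c_1\in(0,1)$ with $f(v)\le c_1f(w)$ whenever $v\in T_w$, $|v|\ge|w|+m$; super-exponential if there is $c_2\in(0,1)$ with $f(v)\ge c_2f(w)$ whenever $v\in S(w)$; exponential if both. A weight function $g$ is uniformly finite if $\sup\{\#\{v\in\Lambda^g_s:K_v\cap K_w\ne\emptyset\}: s\in(0,1],w\in\Lambda^g_s\}<\infty$; it is thick if there are $M\ge1$ and $\alpha>0$ such that for all $s\in(0,1]$ and $w\in\Lambda^g_s$, $K_w\supseteq U^g_M(x,\alpha s)$ for some $x\in K_w$. A function $f:T\to(0,\infty)$ is gentle with respect to a weight function $g$, written $f\sim_{GE}g$, if there is $c>0$ such that $f(v)\le c f(w)$ whenever $w,v\in\Lambda^g_s$ for some $s\in(0,1]$ and $K_w\cap K_v\neq\emptyset$. Metrics and measures. $\mathcal D(X,\mathcal O)$ is the set of metrics $d$ on $X$ inducing $\mathcal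 O$ with $\operatorname{diam}(X,d)=1$; $B_d(x,r)=\{y:d(x,y)<r\}$; $g_d(w)=\operatorname{diam}(K_w,d)$. $d$ is $M$-adapted to $g$ if there are $\alpha_1,\alpha_2>0$ with $U^g_M(x,\alpha_1r)\subseteq B_d(x,r)\subseteq U^g_M(x,\alpha_2r)$ for all $x\in X$, $r>0$; $d$ is adapted if it is $M$-adapted to $g_d$ for some $M\ge0$. $\mathcal M_P(X,\mathcal O)$ is the set of Radon probability measures $\mu$ on $X$ with $\mu(\{x\})=0$ for all $x$ and $\mu(K_w)>0$ for all $w\in T$; $g_\mu(w)=\mu(K_w)$, a weight function. $\mu$ has the volume doubling property with respect to $d$ if there is $C>0$ with $\mu(B_d(x,2r))\le C\mu(B_d(x,r))$ for all $x\in X$, $r>0$. *)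

theory Defs
  imports "HOL-Probability.Probability"
begin

section \<open>Rooted trees\<close>

text \<open>
  A graph on a vertex set \<open>T\<close> is given by its adjacency matrix \<open>A\<close>; only the values of \<open>A\<close>
  on \<open>T\<close> matter. A path is the nonempty list of its vertices.
  The tree predicate of the AFP entry Graph\_Theory cannot be used: it forbids directed cycles,
  and in a symmetric digraph every edge gives a directed cycle of length two.
\<close>

definition adjacency_matrix :: "'t set \<Rightarrow> ('t \<Rightarrow> 't \<Rightarrow> nat) \<Rightarrow> bool" where
  "adjacency_matrix T A \<longleftrightarrow>
     (\<forall>w\<in>T. \<forall>v\<in>T. A w v \<in> {0, 1} \<and> A w v = A v w) \<and> (\<forall>w\<in>T. A w w = 0)"

definition neighbours :: "'t set \<Rightarrow> ('t \<Rightarrow> 't \<Rightarrow> nat) \<Rightarrow> 't \<Rightarrow> 't set" where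
  "neighbours T A w = {v \<in> T. A w v = 1}"

definition simple_path ::
    "'t set \<Rightarrow> ('t \<Rightarrow> 't \<Rightarrow> nat) \<Rightarrow> 't \<Rightarrow> 't \<Rightarrow> 't list \<Rightarrow> bool" where
  "simple_path T A w v p \<longleftrightarrow>
     p \<noteq> [] \<and> hd p = w \<and> last p = v \<and> set p \<subseteq> T \<and>
     successively (\<lambda>a b. A a b = 1) p \<and> distinct p"

definition locally_finite_tree :: "'t set \<Rightarrow> ('t \<Rightarrow> 't \<Rightarrow> nat) \<Rightarrow> bool" where
  "locally_finite_tree T A \<longleftrightarrow>
     adjacency_matrix T A \<and>
     (\<forall>w\<in>T. finite (neighbours T A w)) \<and>
     (\<forall>w\<in>T. \<forall>v\<in>T. \<exists>!p. simple_path T A w v p)"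

definition geodesic :: "'t set \<Rightarrow> ('t \<Rightarrow> 't \<Rightarrow> nat) \<Rightarrow> 't \<Rightarrow> 't \<Rightarrow> 't list" where
  "geodesic T A w v = (THE p. simple_path T A w v p)"

definition height :: "'t set \<Rightarrow> ('t \<Rightarrow> 't \<Rightarrow> nat) \<Rightarrow> 't \<Rightarrow> 't \<Rightarrow> nat" where
  "height T A \<phi> w = length (geodesic T A \<phi> w) - 1"

definition level :: "'t set \<Rightarrow> ('t \<Rightarrow> 't \<Rightarrow> nat) \<Rightarrow> 't \<Rightarrow> nat \<Rightarrow> 't set" where
  "level T A \<phi> m = {w \<in> T. height T A \<phi> w = m}"

definition parent :: "'t set \<Rightarrow> ('t \<Rightarrow> 't \<Rightarrow> nat) \<Rightarrow> 't \<Rightarrow> 't \<Rightarrow> 't" where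
  "parent T A \<phi> w =
     (if w = \<phi> then \<phi>
      else geodesic T A \<phi> w ! (length (geodesic T A \<phi> w) - 2))"

definition children :: "'t set \<Rightarrow> ('t \<Rightarrow> 't \<Rightarrow> nat) \<Rightarrow> 't \<Rightarrow> 't \<Rightarrow> 't set" where
  "children T A \<phi> w = neighbours T A w - {parent T A \<phi> w}"

definition subtree :: "'t set \<Rightarrow> ('t \<Rightarrow> 't \<Rightarrow> nat) \<Rightarrow> 't \<Rightarrow> 't \<Rightarrow> 't set" where
  "subtree T A \<phi> w = {v \<in> T. w \<in> set (geodesic T A \<phi> v)}"

definition rays :: "'t set \<Rightarrow> ('t \<Rightarrow> 't \<Rightarrow> nat) \<Rightarrow> 't \<Rightarrow> (nat \<Rightarrow> 't) set" where
  "rays T A \<phi> =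
     {\<omega>. \<omega> 0 = \<phi> \<and> (\<forall>m. \<omega> m \<in> T \<and> geodesic T A \<phi> (\<omega> m) = map \<omega> [0..<Suc m])}"


section \<open>Partitions and weight functions\<close>

definition parametrized_partition ::
    "'t set \<Rightarrow> ('t \<Rightarrow> 't \<Rightarrow> nat) \<Rightarrow> 't \<Rightarrow> 'x topology \<Rightarrow> ('t \<Rightarrow> 'x set) \<Rightarrow> bool" where
  "parametrized_partition T A \<phi> X K \<longleftrightarrow>
     (\<forall>w\<in>T. K w \<noteq> {} \<and> compactin X (K w)) \<and>
     K \<phi> = topspace X \<and>
     (\<forall>w\<in>T. K w = (\<Union>v\<in>children T A \<phi> w. K v)) \<and>
     (\<forall>\<omega>\<in>rays T A \<phi>. \<exists>x. (\<Inter>m. K (\<omega> m)) = {x})"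

definition weight_function ::
    "'t set \<Rightarrow> ('t \<Rightarrow> 't \<Rightarrow> nat) \<Rightarrow> 't \<Rightarrow> ('t \<Rightarrow> real) \<Rightarrow> bool" where
  "weight_function T A \<phi> g \<longleftrightarrow>
     (\<forall>w\<in>T. 0 < g w \<and> g w \<le> 1) \<and>
     g \<phi> = 1 \<and>
     (\<forall>w\<in>T. g w \<le> g (parent T A \<phi> w)) \<and>
     (\<lambda>m. SUP w\<in>level T A \<phi> m. g w) \<longlonglongrightarrow> 0"

text \<open>
  The set \<open>\<Lambda>\<^sup>g\<^sub>s\<close>, meaningful for \<open>s > 0\<close>.
\<close>

definition scale ::
    "'t set \<Rightarrow> ('t \<Rightarrow> 't \<Rightarrow> nat) \<Rightarrow> 't \<Rightarrow> ('t \<Rightarrow> real) \<Rightarrow> real \<Rightarrow> 't set" where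
  "scale T A \<phi> g s =
     (if s \<ge> 1 then {\<phi>} else {w \<in> T. g (parent T A \<phi> w) > s \<and> s \<ge> g w})"

text \<open>
  The set \<open>U\<^sup>g\<^sub>M(x, s)\<close>; the chain \<open>w(1), \<dots>, w(M + 1)\<close> is a function of which only the values
  on \<open>{1..M + 1}\<close> are used.
\<close>

definition chain_nbhd ::
    "'t set \<Rightarrow> ('t \<Rightarrow> 't \<Rightarrow> nat) \<Rightarrow> 't \<Rightarrow> ('t \<Rightarrow> 'x set) \<Rightarrow> ('t \<Rightarrow> real) \<Rightarrow>
     nat \<Rightarrow> 'x \<Rightarrow> real \<Rightarrow> 'x set" where
  "chain_nbhd T A \<phi> K g M x s =
     {y. \<exists>w :: nat \<Rightarrow> 't.
           (\<forall>i\<in>{1..M + 1}. w i \<in> scale T A \<phi> g s) \<and>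
           x \<in> K (w 1) \<and> y \<in> K (w (M + 1)) \<and>
           (\<forall>i\<in>{1..M}. K (w i) \<inter> K (w (i + 1)) \<noteq> {})}"

definition sub_exponential ::
    "'t set \<Rightarrow> ('t \<Rightarrow> 't \<Rightarrow> nat) \<Rightarrow> 't \<Rightarrow> ('t \<Rightarrow> real) \<Rightarrow> bool" where
  "sub_exponential T A \<phi> f \<longleftrightarrow>
     (\<forall>w\<in>T. 0 < f w) \<and>
     (\<exists>(m::nat). \<exists>c\<^sub>1\<in>{0<..<1}. \<forall>w\<in>T. \<forall>v\<in>subtree T A \<phi> w.
        height T A \<phi> v \<ge> height T A \<phi> w + m \<longrightarrow> f v \<le> c\<^sub>1 * f w)"

definition super_exponential ::
    "'t set \<Rightarrow> ('t \<Rightarrow> 't \<Rightarrow> nat) \<Rightarrow> 't \<Rightarrow> ('t \<Rightarrow> real) \<Rightarrow> bool" where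
  "super_exponential T A \<phi> f \<longleftrightarrow>
     (\<forall>w\<in>T. 0 < f w) \<and>
     (\<exists>c\<^sub>2\<in>{0<..<1}. \<forall>w\<in>T. \<forall>v\<in>children T A \<phi> w. f v \<ge> c\<^sub>2 * f w)"

definition exponential ::
    "'t set \<Rightarrow> ('t \<Rightarrow> 't \<Rightarrow> nat) \<Rightarrow> 't \<Rightarrow> ('t \<Rightarrow> real) \<Rightarrow> bool" where
  "exponential T A \<phi> f \<longleftrightarrow> sub_exponential T A \<phi> f \<and> super_exponential T A \<phi> f"

text \<open>
  Finiteness of the supremum of cardinalities is a uniform bound together with finiteness of the
  sets, since \<^const>\<open>card\<close> is 0 on infinite sets.
\<close>

definition uniformly_finite ::
    "'t set \<Rightarrow> ('t \<Rightarrow> 't \<Rightarrow> nat) \<Rightarrow> 't \<Rightarrow> ('t \<Rightarrow> 'x set) \<Rightarrow> ('t \<Rightarrow> real) \<Rightarrow> bool" where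
  "uniformly_finite T A \<phi> K g \<longleftrightarrow>
     weight_function T A \<phi> g \<and>
     (\<exists>N::nat. \<forall>s\<in>{0<..1}. \<forall>w\<in>scale T A \<phi> g s.
        finite {v \<in> scale T A \<phi> g s. K v \<inter> K w \<noteq> {}} \<and>
        card {v \<in> scale T A \<phi> g s. K v \<inter> K w \<noteq> {}} \<le> N)"

definition thick ::
    "'t set \<Rightarrow> ('t \<Rightarrow> 't \<Rightarrow> nat) \<Rightarrow> 't \<Rightarrow> ('t \<Rightarrow> 'x set) \<Rightarrow> ('t \<Rightarrow> real) \<Rightarrow> bool" where
  "thick T A \<phi> K g \<longleftrightarrow>
     weight_function T A \<phi> g \<and>
     (\<exists>M\<ge>1. \<exists>\<alpha>>0. \<forall>s\<in>{0<..1}. \<forall>w\<in>scale T A \<phi> g s.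
        \<exists>x\<in>K w. chain_nbhd T A \<phi> K g M x (\<alpha> * s) \<subseteq> K w)"

definition gentle ::
    "'t set \<Rightarrow> ('t \<Rightarrow> 't \<Rightarrow> nat) \<Rightarrow> 't \<Rightarrow> ('t \<Rightarrow> 'x set) \<Rightarrow>
     ('t \<Rightarrow> real) \<Rightarrow> ('t \<Rightarrow> real) \<Rightarrow> bool" where
  "gentle T A \<phi> K f g \<longleftrightarrow>
     (\<forall>w\<in>T. 0 < f w) \<and> weight_function T A \<phi> g \<and>
     (\<exists>c>0. \<forall>s\<in>{0<..1}. \<forall>w\<in>scale T A \<phi> g s. \<forall>v\<in>scale T A \<phi> g s.
        K w \<inter> K v \<noteq> {} \<longrightarrow> f v \<le> c * f w)"


section \<open>Metrics and measures\<close>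

text \<open>
  The library's \<^const>\<open>diameter\<close> refers to the metric of the type class; this is its analogue for
  an explicit metric, used on nonempty bounded sets only.
\<close>

definition mdiameter :: "('x \<Rightarrow> 'x \<Rightarrow> real) \<Rightarrow> 'x set \<Rightarrow> real" where
  "mdiameter d S = (SUP (x, y)\<in>S \<times> S. d x y)"

definition normalized_metrics :: "'x topology \<Rightarrow> ('x \<Rightarrow> 'x \<Rightarrow> real) set" where
  "normalized_metrics X =
     {d. Metric_space (topspace X) d \<and> Metric_space.mtopology (topspace X) d = X \<and>
         mdiameter d (topspace X) = 1}"

definition diam_weight :: "('x \<Rightarrow> 'x \<Rightarrow> real) \<Rightarrow> ('t \<Rightarrow> 'x set) \<Rightarrow> 't \<Rightarrow> real" where
  "diam_weight d K w = mdiameter d (K w)"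

definition M_adapted ::
    "'t set \<Rightarrow> ('t \<Rightarrow> 't \<Rightarrow> nat) \<Rightarrow> 't \<Rightarrow> 'x topology \<Rightarrow> ('t \<Rightarrow> 'x set) \<Rightarrow>
     nat \<Rightarrow> ('x \<Rightarrow> 'x \<Rightarrow> real) \<Rightarrow> ('t \<Rightarrow> real) \<Rightarrow> bool" where
  "M_adapted T A \<phi> X K M d g \<longleftrightarrow>
     (\<exists>\<alpha>\<^sub>1>0. \<exists>\<alpha>\<^sub>2>0. \<forall>x\<in>topspace X. \<forall>r>0.
        chain_nbhd T A \<phi> K g M x (\<alpha>\<^sub>1 * r) \<subseteq> Metric_space.mball (topspace X) d x r \<and>
        Metric_space.mball (topspace X) d x r \<subseteq> chain_nbhd T A \<phi> K g M x (\<alpha>\<^sub>2 * r))"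

definition adapted ::
    "'t set \<Rightarrow> ('t \<Rightarrow> 't \<Rightarrow> nat) \<Rightarrow> 't \<Rightarrow> 'x topology \<Rightarrow> ('t \<Rightarrow> 'x set) \<Rightarrow>
     ('x \<Rightarrow> 'x \<Rightarrow> real) \<Rightarrow> bool" where
  "adapted T A \<phi> X K d \<longleftrightarrow> (\<exists>M. M_adapted T A \<phi> X K M d (diam_weight d K))"

text \<open>
  A Radon probability measure is a Borel probability measure that is inner regular with respect
  to compact sets; local finiteness is automatic.
\<close>

definition radon_probability :: "'x topology \<Rightarrow> 'x measure \<Rightarrow> bool" where
  "radon_probability X \<mu> \<longleftrightarrow>
     prob_space \<mu> \<and>
     sets \<mu> = sets (sigma (topspace X) {U. openin X U}) \<and>
     (\<forall>B\<in>sets \<mu>. emeasure \<mu> B = (SUP C\<in>{C. compactin X C \<and> C \<subseteq> B}. emeasure \<mu> C))"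

definition partition_measures ::
    "'t set \<Rightarrow> 'x topology \<Rightarrow> ('t \<Rightarrow> 'x set) \<Rightarrow> 'x measure set" where
  "partition_measures T X K =
     {\<mu>. radon_probability X \<mu> \<and> (\<forall>x\<in>topspace X. measure \<mu> {x} = 0) \<and>
         (\<forall>w\<in>T. measure \<mu> (K w) > 0)}"

definition measure_weight :: "'x measure \<Rightarrow> ('t \<Rightarrow> 'x set) \<Rightarrow> 't \<Rightarrow> real" where
  "measure_weight \<mu> K w = measure \<mu> (K w)"

definition volume_doubling ::
    "'x topology \<Rightarrow> ('x \<Rightarrow> 'x \<Rightarrow> real) \<Rightarrow> 'x measure \<Rightarrow> bool" where
  "volume_doubling X d \<mu> \<longleftrightarrow>
     (\<exists>C>0. \<forall>x\<in>topspace X. \<forall>r>0.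
        measure \<mu> (Metric_space.mball (topspace X) d x (2 * r))
          \<le> C * measure \<mu> (Metric_space.mball (topspace X) d x r))"

end

theory Submission
  imports Defs
begin

text \<open>
  For exponential weight functions gentleness is a symmetric relation, since bounded ratios of one
  weight along a branch mean boundedly many generations and hence bounded ratios of the other. So
  the claim is that doubling is equivalent to \<open>\<mu>(K\<^sub>v) \<le> c \<mu>(K\<^sub>w)\<close> for meeting cells of the same
  \<open>d\<close>-scale. Doubling gives this because, by thickness, \<open>K\<^sub>w\<close> contains a ball of comparable radius.
  Conversely, a ball is covered by boundedly many cells of its scale that are linked by chains of
  bounded length, and it contains a cell of comparable scale.
\<close>

section \<open>Rooted trees\<close>

text \<open>Thickness and adaptedness each bring a chain length of their own, and balls are
  controlled only by chains of the length that adaptedness brings; therefore thickness is first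
  extended to every chain length. Doubling concerns all radii, whereas uniform finiteness, thickness
  and gentleness speak of scales at most 1; beyond 1 the root is the only cell left, and its measure
  1 bounds that of every ball.\<close>

locale rooted_tree =
  fixes T :: "'t set" and A :: "'t \<Rightarrow> 't \<Rightarrow> nat" and \<phi> :: 't
  assumes tree: "locally_finite_tree T A"
    and root_in: "\<phi> \<in> T"
begin

abbreviation "path_to \<equiv> geodesic T A \<phi>"
abbreviation "par \<equiv> parent T A \<phi>"
abbreviation "ch \<equiv> children T A \<phi>"
abbreviation "ht \<equiv> height T A \<phi>"
abbreviation "sub \<equiv> subtree T A \<phi>"
abbreviation "weight \<equiv> weight_function T A \<phi>"
abbreviation "\<Lambda> \<equiv> scale T A \<phi>"

lemma simple_path_unique:
  assumes "simple_path T A w v p" and "simple_path T A w v q"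
  shows "p = q"
proof -
  have "w \<in> T" "v \<in> T"
    using assms(1) unfolding simple_path_def by (metis hd_in_set last_in_set subsetD)+
  then show ?thesis
    using tree assms unfolding locally_finite_tree_def by blast
qed

lemma simple_path_geodesic:
  assumes "v \<in> T"
  shows "simple_path T A \<phi> v (path_to v)"
proof -
  have "\<exists>!p. simple_path T A \<phi> v p"
    using tree assms root_in unfolding locally_finite_tree_def by blast
  then show ?thesis
    unfolding geodesic_def by (rule theI')
qed

lemma geodesic_eqI: "simple_path T A \<phi> v p \<Longrightarrow> path_to v = p"
  unfolding geodesic_def using simple_path_unique by blast

lemma geodesic_root: "path_to \<phi> = [\<phi>]"
  by (rule geodesic_eqI) (simp add: simple_path_def root_in)

lemma height_root [simp]: "ht \<phi> = 0"
  by (simp add: height_def geodesic_root)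

lemma parent_root [simp]: "par \<phi> = \<phi>"
  by (simp add: parent_def)

lemma adjacent_sym: "w \<in> T \<Longrightarrow> v \<in> T \<Longrightarrow> A w v = A v w"
  using tree unfolding locally_finite_tree_def adjacency_matrix_def by blast

lemma adjacent_irrefl: "w \<in> T \<Longrightarrow> A w w = 0"
  using tree unfolding locally_finite_tree_def adjacency_matrix_def by blast

text \<open>If \<open>v\<close> were already on the geodesic to \<open>u\<close>, the part of it
  from \<open>v\<close> on would be the unique path from \<open>v\<close> to \<open>u\<close>, hence
  the single edge, and \<open>v\<close> would be the parent of \<open>u\<close>.\<close>

lemma geodesic_child:
  assumes u: "u \<in> T" and v: "v \<in> ch u"
  shows "path_to v = path_to u @ [v]"
proof (rule geodesic_eqI)
  have vT: "v \<in> T" and Auv: "A u v = 1" and npar: "v \<noteq> par u"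
    using v by (auto simp: children_def neighbours_def)
  have uv: "u \<noteq> v"
    using adjacent_irrefl[OF u] Auv by auto
  have p: "simple_path T A \<phi> u (path_to u)"
    by (rule simple_path_geodesic[OF u])
  have "v \<notin> set (path_to u)"
  proof
    assume "v \<in> set (path_to u)"
    then obtain p q where pq: "path_to u = p @ v # q"
      by (meson split_list)
    have "simple_path T A v u (v # q)"
      using p unfolding simple_path_def pq by (auto simp: successively_append_iff)
    moreover have "simple_path T A v u [v, u]"
      using vT u uv Auv adjacent_sym[OF u vT] by (auto simp: simple_path_def)
    ultimately have "q = [u]"
      using simple_path_unique by fastforce
    then have pq': "path_to u = p @ [v, u]"
      using pq by simp
    moreover have "u \<noteq> \<phi>"
      using pq' geodesic_root by auto
    ultimately have "par u = v"
      by (simp add: parent_def nth_append)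
    then show False
      using npar by simp
  qed
  then show "simple_path T A \<phi> v (path_to u @ [v])"
    using p vT Auv unfolding simple_path_def by (auto simp: successively_append_iff)
qed

lemma
  assumes "u \<in> T" and "v \<in> ch u"
  shows child_in: "v \<in> T"
    and parent_child: "par v = u"
    and height_child: "ht v = Suc (ht u)"
proof -
  show "v \<in> T"
    using assms(2) by (simp add: children_def neighbours_def)
  have p: "path_to u \<noteq> []" "hd (path_to u) = \<phi>" "last (path_to u) = u"
    using simple_path_geodesic[OF assms(1)] by (auto simp: simple_path_def)
  have g: "path_to v = path_to u @ [v]"
    by (rule geodesic_child[OF assms])
  have "v \<noteq> \<phi>"
    using g p geodesic_root by auto
  then show "par v = u"
    using p g by (simp add: parent_def nth_append last_conv_nth)
  show "ht v = Suc (ht u)"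
    using p g by (simp add: height_def)
qed

lemma
  assumes w: "w \<in> T" and nroot: "w \<noteq> \<phi>"
  shows parent_in: "par w \<in> T"
    and child_of_parent: "w \<in> ch (par w)"
proof -
  have p: "simple_path T A \<phi> w (path_to w)"
    by (rule simple_path_geodesic[OF w])
  define p where "p = butlast (path_to w)"
  define u where "u = last p"
  have g: "path_to w = p @ [w]"
    using p unfolding simple_path_def p_def by (metis append_butlast_last_id)
  have pne: "p \<noteq> []"
    using p g nroot unfolding simple_path_def by auto
  have up: "u \<in> set p"
    using pne by (simp add: u_def)
  have uT: "u \<in> T"
    using p g up unfolding simple_path_def by auto
  have "simple_path T A \<phi> u p"
    using p g pne unfolding simple_path_def u_def by (auto simp: successively_append_iff)
  then have gu: "path_to u = p"
    by (rule geodesic_eqI)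
  have par: "par w = u"
    using g pne nroot by (simp add: parent_def nth_append u_def last_conv_nth)
  \<comment> \<open>\<open>children\<close> excludes only the parent, so \<open>w\<close> has to be
    told apart from its grandparent \<open>par u\<close>: the latter lies on \<open>p\<close>, which
    \<open>w\<close> does not.\<close>
  have "par u \<in> set p"
  proof (cases "u = \<phi>")
    case True
    then show ?thesis using up by simp
  next
    case False
    then show ?thesis
      using gu pne by (auto simp: parent_def)
  qed
  moreover have "w \<notin> set p"
    using p g unfolding simple_path_def by simp
  moreover have "A u w = 1"
    using p g pne unfolding simple_path_def u_def by (auto simp: successively_append_iff)
  ultimately show "par w \<in> T" "w \<in> ch (par w)"
    using par uT w by (auto simp: children_def neighbours_def)
qed

lemma subtree_in: "v \<in> sub w \<Longrightarrow> v \<in> T"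
  by (simp add: subtree_def)

lemma subtree_refl: "w \<in> T \<Longrightarrow> w \<in> sub w"
  using simple_path_geodesic[of w] unfolding simple_path_def subtree_def by (metis (mono_tags, lifting) last_in_set mem_Collect_eq)

lemma subtree_child: "u \<in> sub w \<Longrightarrow> v \<in> ch u \<Longrightarrow> v \<in> sub w"
  using geodesic_child[of u v] child_in[of u v] by (auto simp: subtree_def)

text \<open>The geodesic to a vertex \<open>v \<noteq> w\<close> of the subtree still contains
  \<open>w\<close> when its last vertex is dropped, so strong induction on the height applies. The
  rule replaces geodesics by descent through children.\<close>

lemma subtree_induct [consumes 1, case_names base step]:
  assumes "v \<in> sub w"
    and base: "P w"
    and step: "\<And>u v. u \<in> sub w \<Longrightarrow> P u \<Longrightarrow> v \<in> ch u \<Longrightarrow> P v"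
  shows "P v"
  using assms(1)
proof (induction "ht v" arbitrary: v rule: less_induct)
  case less
  have v: "v \<in> T" "w \<in> set (path_to v)"
    using less.prems by (auto simp: subtree_def)
  show ?case
  proof (cases "v = w")
    case True
    then show ?thesis using base by simp
  next
    case False
    then have nroot: "v \<noteq> \<phi>"
      using v geodesic_root by auto
    define u where "u = par v"
    have u: "u \<in> T" "v \<in> ch u"
      unfolding u_def by (rule parent_in[OF v(1) nroot], rule child_of_parent[OF v(1) nroot])
    have "u \<in> sub w"
      using v u geodesic_child[OF u] False by (auto simp: subtree_def)
    moreover have "ht u < ht v"
      using height_child[OF u] by simp
    ultimately show ?thesis
      using less.hyps step u(2) by blast
  qed
qed

lemma subtree_root: "v \<in> T \<Longrightarrow> v \<in> sub \<phi>"
  using simple_path_geodesic[of v] unfolding simple_path_def subtree_def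
  by (metis (mono_tags, lifting) hd_in_set mem_Collect_eq)

lemma subtree_height: "v \<in> sub w \<Longrightarrow> ht w \<le> ht v"
proof (induction rule: subtree_induct)
  case (step u v)
  then show ?case using height_child[OF subtree_in] by simp
qed simp

text \<open>Cuts a branch into blocks of generations along which an estimate can be iterated, and
  finds the ancestor at a level where a weight is already small.\<close>

lemma subtree_intermediate:
  assumes "w \<in> T" and "v \<in> sub w" and "ht w + n \<le> ht v"
  shows "\<exists>u\<in>sub w. ht u = ht w + n \<and> v \<in> sub u"
  using assms(2,3)
proof (induction rule: subtree_induct)
  case base
  then show ?case using subtree_refl[OF assms(1)] by auto
next
  case (step u v)
  have hv: "ht v = Suc (ht u)"
    using height_child[OF subtree_in] step by blast
  show ?case
  proof (cases "ht w + n \<le> ht u")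
    case True
    then show ?thesis using step subtree_child by blast
  next
    case False
    then have "ht v = ht w + n"
      using hv step.prems by simp
    moreover have "v \<in> sub w"
      using step subtree_child by blast
    ultimately show ?thesis
      using subtree_refl[OF subtree_in] by blast
  qed
qed


section \<open>Exponential functions and weight functions\<close>

lemma sub_exponential_decay:
  assumes f: "sub_exponential T A \<phi> f" and e: "\<epsilon> > 0"
  shows "\<exists>n. \<forall>w\<in>T. \<forall>v\<in>sub w. ht w + n \<le> ht v \<longrightarrow> f v < \<epsilon> * f w"
proof -
  obtain m c where c: "0 < c" "c < 1"
    and sub: "\<And>w v. w \<in> T \<Longrightarrow> v \<in> sub w \<Longrightarrow> ht w + m \<le> ht v \<Longrightarrow> f v \<le> c * f w"
    using f unfolding sub_exponential_def Bex_def greaterThanLessThan_iff by blast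
  have pos: "\<And>w. w \<in> T \<Longrightarrow> 0 < f w"
    using f unfolding sub_exponential_def by blast
  obtain k where k: "c ^ k < \<epsilon>"
    using real_arch_pow_inv[OF e c(2)] by blast
  \<comment> \<open>One block of \<open>m\<close> generations is given away: \<open>f\<close> need
    not decrease along a branch, so \<open>f v \<le> f w\<close> is known only after
    \<open>m\<close> generations and the induction cannot start at distance 0.\<close>
  have iter: "f v \<le> c ^ k * f w" if "w \<in> T" "v \<in> sub w" "ht w + Suc k * m \<le> ht v" for k w v
    using that
  proof (induction k arbitrary: v)
    case 0
    have "f v \<le> c * f w"
      using sub 0 by simp
    also have "\<dots> \<le> f w"
      using c pos[OF 0(1)] by simp
    finally show ?case by simp
  next
    case (Suc k)
    obtain u where u: "u \<in> sub w" "ht u = ht w + Suc k * m" "v \<in> sub u"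
      using subtree_intermediate[OF Suc.prems(1,2), of "Suc k * m"] Suc.prems(3) by auto
    have "f v \<le> c * f u"
      using sub[OF subtree_in[OF u(1)] u(3)] u(2) Suc.prems(3) by simp
    also have "f u \<le> c ^ k * f w"
      using Suc.IH[OF Suc.prems(1) u(1)] u(2) by simp
    finally show ?case
      using c by (simp add: mult.assoc)
  qed
  show ?thesis
  proof (intro exI ballI impI)
    fix w v
    assume w: "w \<in> T" "v \<in> sub w" "ht w + Suc k * m \<le> ht v"
    have "f v \<le> c ^ k * f w"
      by (rule iter[OF w])
    also have "\<dots> < \<epsilon> * f w"
      using k pos[OF w(1)] by simp
    finally show "f v < \<epsilon> * f w" .
  qed
qed

lemma super_exponential_growth:
  assumes f: "super_exponential T A \<phi> f"
  shows "\<exists>c\<in>{0<..<1}. \<forall>w\<in>T. \<forall>v\<in>sub w. c ^ (ht v - ht w) * f w \<le> f v"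
proof -
  obtain c where c: "c \<in> {0<..<1}"
    and sup: "\<And>w v. w \<in> T \<Longrightarrow> v \<in> ch w \<Longrightarrow> c * f w \<le> f v"
    using f unfolding super_exponential_def by blast
  have "c ^ (ht v - ht w) * f w \<le> f v" if "v \<in> sub w" for w v
    using that
  proof (induction rule: subtree_induct)
    case (step u v)
    have u: "u \<in> T"
      using step subtree_in by blast
    have "ht v - ht w = Suc (ht u - ht w)"
      using height_child[OF u step.hyps(2)] subtree_height[OF step(1)] by simp
    then have "c ^ (ht v - ht w) * f w = c * (c ^ (ht u - ht w) * f w)"
      by (simp add: mult.assoc)
    also have "\<dots> \<le> c * f u"
      using step.IH c by simp
    also have "\<dots> \<le> f v"
      by (rule sup[OF u step.hyps(2)])
    finally show ?case .
  qed simp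
  then show ?thesis
    using c by blast
qed

text \<open>
  A lower bound on \<open>f v / f w\<close> bounds the number of generations between \<open>w\<close> and \<open>v\<close>.
\<close>

lemma exponential_transfer:
  assumes f: "sub_exponential T A \<phi> f" and h: "super_exponential T A \<phi> h" and e: "\<epsilon> > 0"
  shows "\<exists>\<delta>>0. \<forall>w\<in>T. \<forall>v\<in>sub w. \<epsilon> * f w \<le> f v \<longrightarrow> \<delta> * h w \<le> h v"
proof -
  obtain n where n: "\<forall>w\<in>T. \<forall>v\<in>sub w. ht w + n \<le> ht v \<longrightarrow> f v < \<epsilon> * f w"
    using sub_exponential_decay[OF f e] by blast
  obtain c where c: "c \<in> {0<..<1}"
    and growth: "\<forall>w\<in>T. \<forall>v\<in>sub w. c ^ (ht v - ht w) * h w \<le> h v"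
    using super_exponential_growth[OF h] by blast
  have "c ^ n * h w \<le> h v" if w: "w \<in> T" and v: "v \<in> sub w" and le: "\<epsilon> * f w \<le> f v" for w v
  proof -
    have "ht v - ht w \<le> n"
      using n w v le by fastforce
    then have "c ^ n \<le> c ^ (ht v - ht w)"
      using c by (intro power_decreasing) auto
    moreover have "0 < h w"
      using h w unfolding super_exponential_def by blast
    ultimately have "c ^ n * h w \<le> c ^ (ht v - ht w) * h w"
      by simp
    then show ?thesis
      using growth w v by force
  qed
  then show ?thesis
    using c by (intro exI[of _ "c ^ n"]) simp
qed

section \<open>Weight functions and their scales\<close>

lemma
  assumes "weight g" and "w \<in> T"
  shows weight_pos: "0 < g w" and weight_le_1: "g w \<le> 1" and weight_parent: "g w \<le> g (par w)"
  using assms unfolding weight_function_def by blast+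

lemma weight_root: "weight g \<Longrightarrow> g \<phi> = 1"
  unfolding weight_function_def by blast

lemma weight_subtree:
  assumes "weight g" and "v \<in> sub w"
  shows "g v \<le> g w"
  using assms(2)
proof (induction rule: subtree_induct)
  case (step u v)
  have u: "u \<in> T"
    using step.hyps(1) by (rule subtree_in)
  have "g v \<le> g (par v)"
    by (rule weight_parent[OF assms(1) child_in[OF u step.hyps(2)]])
  then show ?case
    using step.IH parent_child[OF u step.hyps(2)] by simp
qed simp

lemma weight_small:
  assumes g: "weight g" and s: "0 < s"
  shows "\<exists>n. \<forall>w\<in>T. ht w = n \<longrightarrow> g w \<le> s"
proof -
  have "(\<lambda>m. SUP w\<in>level T A \<phi> m. g w) \<longlonglongrightarrow> 0"
    using g unfolding weight_function_def by blast
  then have "\<forall>\<^sub>F m in sequentially. (SUP w\<in>level T A \<phi> m. g w) < s"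
    using s by (rule order_tendstoD)
  then obtain n where n: "\<And>m. m \<ge> n \<Longrightarrow> (SUP w\<in>level T A \<phi> m. g w) < s"
    unfolding eventually_sequentially by blast
  have "g w \<le> s" if "w \<in> T" "ht w = n" for w
  proof -
    have "bdd_above (g ` level T A \<phi> n)"
      using weight_le_1[OF g] by (intro bdd_aboveI[of _ 1]) (auto simp: level_def)
    then have "g w \<le> (SUP w\<in>level T A \<phi> n. g w)"
      using that by (intro cSUP_upper) (auto simp: level_def)
    then show ?thesis
      using n[of n] by simp
  qed
  then show ?thesis by blast
qed

text \<open>Absorbs the case distinction at \<open>s = 1\<close>: the root behaves as if its parent
  had infinite weight. For \<open>s \<ge> 1\<close> no parent weight exceeds \<open>s\<close>, and
  for \<open>s < 1\<close> the root, of weight 1, violates \<open>g w \<le> s\<close>.\<close>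

lemma scale_iff:
  assumes "weight g"
  shows "w \<in> \<Lambda> g s \<longleftrightarrow> w \<in> T \<and> g w \<le> s \<and> (w = \<phi> \<or> s < g (par w))"
proof (cases "w = \<phi>")
  case True
  then show ?thesis
    using weight_root[OF assms] root_in by (auto simp: scale_def)
next
  case False
  then have "g (par w) \<le> 1" if "w \<in> T"
    using weight_le_1[OF assms] parent_in that by blast
  then show ?thesis
    using False by (auto simp: scale_def)
qed

text \<open>The vertex found is the first one on the branch from \<open>w\<close> to
  \<open>v\<close> whose weight is at most \<open>s\<close>; the condition on \<open>par w\<close>
  excludes that the threshold was crossed above \<open>w\<close>.\<close>

lemma scale_subtree_ancestor:
  assumes g: "weight g" and v: "v \<in> sub w" and w: "w \<in> T"
    and gv: "g v \<le> s" and gw: "w = \<phi> \<or> s < g (par w)"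
  shows "\<exists>u\<in>\<Lambda> g s. u \<in> sub w \<and> v \<in> sub u"
  using v gv
proof (induction rule: subtree_induct)
  case base
  then have "w \<in> \<Lambda> g s"
    using scale_iff[OF g] w gw by blast
  then show ?case
    using subtree_refl[OF w] by blast
next
  case (step u v)
  show ?case
  proof (cases "g u \<le> s")
    case True
    then show ?thesis
      using step subtree_child by blast
  next
    case False
    have vT: "v \<in> sub w" "v \<in> T" "par v = u"
      using step subtree_child subtree_in parent_child by blast+
    then have "v \<in> \<Lambda> g s"
      using scale_iff[OF g] False step.prems by simp
    then show ?thesis
      using vT subtree_refl by blast
  qed
qed

lemma scale_ancestor:
  assumes "weight g" and "v \<in> T" and "g v \<le> s"
  shows "\<exists>u\<in>\<Lambda> g s. v \<in> sub u"
  using scale_subtree_ancestor[OF assms(1) subtree_root[OF assms(2)] root_in assms(3)] by blast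

text \<open>The parent of a cell is still heavier than the scale, and one generation costs at most
  the super-exponential constant. The minimum with 1 accounts for large scales, where the root is
  the only cell.\<close>

lemma scale_lower_bound:
  assumes g: "weight g" and f: "super_exponential T A \<phi> g"
  shows "\<exists>c\<in>{0<..<1}. \<forall>s. \<forall>w\<in>\<Lambda> g s. c * min s 1 \<le> g w"
proof -
  obtain c where c: "c \<in> {0<..<1}"
    and sup: "\<And>w v. w \<in> T \<Longrightarrow> v \<in> ch w \<Longrightarrow> c * g w \<le> g v"
    using f unfolding super_exponential_def by blast
  have "c * min s 1 \<le> g w" if w: "w \<in> \<Lambda> g s" for s w
  proof (cases "w = \<phi>")
    case True
    have "c * min s 1 \<le> c * 1"
      using c by (intro mult_left_mono) auto
    also have "\<dots> \<le> g w"
      using True weight_root[OF g] c by simp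
    finally show ?thesis .
  next
    case False
    have wT: "w \<in> T" and sw: "s < g (par w)"
      using w False scale_iff[OF g] by blast+
    have "c * min s 1 \<le> c * g (par w)"
      using c sw by (intro mult_left_mono) auto
    also have "\<dots> \<le> g w"
      using sup parent_in[OF wT False] child_of_parent[OF wT False] by blast
    finally show ?thesis .
  qed
  then show ?thesis
    using c by blast
qed

end


section \<open>Partitions\<close>

locale tree_partition = rooted_tree T A \<phi>
  for T :: "'t set" and A :: "'t \<Rightarrow> 't \<Rightarrow> nat" and \<phi> :: 't +
  fixes X :: "'x topology" and K :: "'t \<Rightarrow> 'x set"
  assumes partition: "parametrized_partition T A \<phi> X K"
begin

abbreviation "U \<equiv> chain_nbhd T A \<phi> K"

lemma cell_nonempty: "w \<in> T \<Longrightarrow> K w \<noteq> {}"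
  and cell_compact: "w \<in> T \<Longrightarrow> compactin X (K w)"
  and cell_root: "K \<phi> = topspace X"
  and cell_children: "w \<in> T \<Longrightarrow> K w = (\<Union>v\<in>ch w. K v)"
  using partition unfolding parametrized_partition_def by blast+

lemma cell_subtree:
  assumes "v \<in> sub w"
  shows "K v \<subseteq> K w"
  using assms
proof (induction rule: subtree_induct)
  case (step u v)
  then show ?case
    using cell_children subtree_in by blast
qed simp

lemma cell_subset: "w \<in> T \<Longrightarrow> K w \<subseteq> topspace X"
  using cell_subtree[OF subtree_root] cell_root by simp

lemma subtree_cell_height:
  assumes "w \<in> T" and "x \<in> K w"
  shows "\<exists>v\<in>sub w. ht v = ht w + n \<and> x \<in> K v"
proof (induction n)
  case 0
  then show ?case
    using assms subtree_refl by auto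
next
  case (Suc n)
  then obtain u where u: "u \<in> sub w" "ht u = ht w + n" "x \<in> K u"
    by blast
  then obtain v where v: "v \<in> ch u" "x \<in> K v"
    using cell_children subtree_in by blast
  then show ?case
    using u subtree_child height_child subtree_in by fastforce
qed

text \<open>Descending from \<open>w\<close> through cells that contain \<open>x\<close> leads to
  weights at most \<open>s\<close>, so the threshold is crossed on the way.\<close>

lemma scale_descendant:
  assumes g: "weight g" and s: "0 < s" and w: "w \<in> T" "x \<in> K w" and gw: "w = \<phi> \<or> s < g (par w)"
  shows "\<exists>v\<in>\<Lambda> g s. v \<in> sub w \<and> x \<in> K v"
proof -
  obtain n where n: "\<forall>w\<in>T. ht w = n \<longrightarrow> g w \<le> s"
    using weight_small[OF g s] by blast
  obtain v where v: "v \<in> sub w" "ht v = ht w + n" "x \<in> K v"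
    using subtree_cell_height[OF w] by blast
  \<comment> \<open>Smallness is known on the level \<open>n\<close> counted from the root, while
    \<open>v\<close> lies \<open>n\<close> generations below \<open>w\<close>; the ancestor of
    \<open>v\<close> on level \<open>n\<close> passes its bound on to \<open>v\<close>.\<close>
  obtain u where u: "u \<in> sub \<phi>" "ht u = n" "v \<in> sub u"
    using subtree_intermediate[OF root_in subtree_root[OF subtree_in[OF v(1)]], of n] v(2) by auto
  have "g u \<le> s"
    using n u subtree_in by blast
  then have "g v \<le> s"
    using weight_subtree[OF g u(3)] by simp
  then obtain t where "t \<in> \<Lambda> g s" "t \<in> sub w" "v \<in> sub t"
    using scale_subtree_ancestor[OF g v(1) w(1) _ gw] by blast
  then show ?thesis
    using v(3) cell_subtree by blast
qed

lemma scale_cover: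
  assumes "weight g" and "0 < s" and "x \<in> topspace X"
  shows "\<exists>w\<in>\<Lambda> g s. x \<in> K w"
  using scale_descendant[OF assms(1,2) root_in] assms(3) cell_root by blast

lemma scale_coarsen:
  assumes g: "weight g" and "v \<in> \<Lambda> g s" and "s \<le> t"
  shows "\<exists>u\<in>\<Lambda> g t. K v \<subseteq> K u"
proof -
  have "v \<in> T" "g v \<le> t"
    using assms scale_iff[OF g] by auto
  then show ?thesis
    using scale_ancestor[OF g] cell_subtree by blast
qed

section \<open>Chain neighbourhoods and thickness\<close>

lemma chain_nbhd_0: "y \<in> U g 0 x s \<longleftrightarrow> (\<exists>w\<in>\<Lambda> g s. x \<in> K w \<and> y \<in> K w)"
  by (auto simp: chain_nbhd_def)

text \<open>Peels off the last cell of a chain; from here on chains are treated by induction on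
  \<open>M\<close> and never as explicit sequences.\<close>

lemma chain_nbhd_Suc:
  "y \<in> U g (Suc M) x s \<longleftrightarrow> (\<exists>w\<in>\<Lambda> g s. y \<in> K w \<and> K w \<inter> U g M x s \<noteq> {})"
proof
  assume "y \<in> U g (Suc M) x s"
  then obtain w :: "nat \<Rightarrow> 't" where w: "\<forall>i\<in>{1..Suc M + 1}. w i \<in> \<Lambda> g s"
    "x \<in> K (w 1)" "y \<in> K (w (Suc M + 1))" "\<forall>i\<in>{1..Suc M}. K (w i) \<inter> K (w (i + 1)) \<noteq> {}"
    unfolding chain_nbhd_def by blast
  then obtain z where z: "z \<in> K (w (M + 1))" "z \<in> K (w (Suc M + 1))"
    by fastforce
  have "z \<in> U g M x s"
    unfolding chain_nbhd_def mem_Collect_eq using w z by (intro exI[of _ w]) auto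
  then show "\<exists>w\<in>\<Lambda> g s. y \<in> K w \<and> K w \<inter> U g M x s \<noteq> {}"
    using w z by (intro bexI[of _ "w (Suc M + 1)"]) auto
next
  assume "\<exists>w\<in>\<Lambda> g s. y \<in> K w \<and> K w \<inter> U g M x s \<noteq> {}"
  then obtain v z where v: "v \<in> \<Lambda> g s" "y \<in> K v" "z \<in> K v" "z \<in> U g M x s"
    by blast
  then obtain w :: "nat \<Rightarrow> 't" where w: "\<forall>i\<in>{1..M + 1}. w i \<in> \<Lambda> g s"
    "x \<in> K (w 1)" "z \<in> K (w (M + 1))" "\<forall>i\<in>{1..M}. K (w i) \<inter> K (w (i + 1)) \<noteq> {}"
    unfolding chain_nbhd_def by blast
  \<comment> \<open>Chains are indexed from 1, so one of length parameter \<open>M\<close> ends at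
    \<open>M + 1\<close> and the new cell takes the index \<open>M + 2\<close>.\<close>
  define w' where "w' = w(M + 2 := v)"
  have "\<forall>i\<in>{1..Suc M + 1}. w' i \<in> \<Lambda> g s"
    using w(1) v(1) by (auto simp: w'_def)
  moreover have "x \<in> K (w' 1)" "y \<in> K (w' (Suc M + 1))"
    using w v by (auto simp: w'_def)
  moreover have "K (w' i) \<inter> K (w' (i + 1)) \<noteq> {}" if "i \<in> {1..Suc M}" for i
  proof (cases "i = Suc M")
    case True
    then show ?thesis
      using w(3) v(3) by (auto simp: w'_def)
  next
    case False
    then have "i \<in> {1..M}"
      using that by auto
    then show ?thesis
      using w(4) by (auto simp: w'_def)
  qed
  ultimately show "y \<in> U g (Suc M) x s"
    unfolding chain_nbhd_def by blast
qed

text \<open>Every cell of a chain is replaced by an ancestor in the coarser scale; cells only grow,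
  so consecutive ones still meet.\<close>

lemma chain_nbhd_mono_scale:
  assumes g: "weight g" and st: "s \<le> t"
  shows "U g M x s \<subseteq> U g M x t"
proof (induction M)
  case 0
  show ?case
    unfolding subset_iff chain_nbhd_0 using scale_coarsen[OF g _ st] by blast
next
  case (Suc M)
  show ?case
  proof
    fix y
    assume "y \<in> U g (Suc M) x s"
    then obtain w where w: "w \<in> \<Lambda> g s" "y \<in> K w" "K w \<inter> U g M x s \<noteq> {}"
      using chain_nbhd_Suc by blast
    obtain u where "u \<in> \<Lambda> g t" "K w \<subseteq> K u"
      using scale_coarsen[OF g w(1) st] by blast
    then show "y \<in> U g (Suc M) x t"
      using w Suc.IH chain_nbhd_Suc by blast
  qed
qed

text \<open>The last cell of the chain is repeated; it meets itself in \<open>y\<close>.\<close>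

lemma chain_nbhd_Suc_subset: "U g M x s \<subseteq> U g (Suc M) x s"
proof
  fix y
  assume y: "y \<in> U g M x s"
  have "\<exists>w\<in>\<Lambda> g s. y \<in> K w"
    using y by (cases M) (auto simp: chain_nbhd_0 chain_nbhd_Suc)
  then show "y \<in> U g (Suc M) x s"
    using y chain_nbhd_Suc by blast
qed

lemma chain_nbhd_mono_length: "M \<le> N \<Longrightarrow> U g M x s \<subseteq> U g N x s"
  by (rule lift_Suc_mono_le[of "\<lambda>M. U g M x s"]) (rule chain_nbhd_Suc_subset)

text \<open>
  Lengthening the chains by one costs one passage to a finer scale: a chain that stays in a cell
  \<open>K\<^sub>v\<close> of the finer scale \<open>\<alpha> s\<close> around the centre of \<open>K\<^sub>w\<close> may take one more step before it can
  leave \<open>K\<^sub>w\<close>.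
\<close>

lemma thick_all_lengths:
  assumes "thick T A \<phi> K g"
  shows "\<exists>\<alpha>>0. \<forall>s\<in>{0<..1}. \<forall>w\<in>\<Lambda> g s. \<exists>x\<in>K w. U g M x (\<alpha> * s) \<subseteq> K w"
proof -
  have g: "weight g"
    using assms unfolding thick_def by blast
  obtain L \<alpha>' where L: "1 \<le> L" and \<alpha>': "0 < \<alpha>'"
    and th': "\<And>s w. s \<in> {0<..1} \<Longrightarrow> w \<in> \<Lambda> g s \<Longrightarrow> \<exists>x\<in>K w. U g L x (\<alpha>' * s) \<subseteq> K w"
    using assms unfolding thick_def by blast
  \<comment> \<open>Capped at 1 so that \<open>\<alpha> * s\<close> stays in the range of scales to
    which thickness applies again.\<close>
  define \<alpha> where "\<alpha> = min \<alpha>' 1"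
  have \<alpha>: "0 < \<alpha>" "\<alpha> \<le> 1" "\<alpha> \<le> \<alpha>'"
    using \<alpha>' by (auto simp: \<alpha>_def)
  have th: "\<exists>x\<in>K w. U g 1 x (\<alpha> * s) \<subseteq> K w" if s: "s \<in> {0<..1}" and w: "w \<in> \<Lambda> g s" for s w
  proof -
    have "U g 1 x (\<alpha> * s) \<subseteq> U g L x (\<alpha>' * s)" for x
      using chain_nbhd_mono_length[OF L] chain_nbhd_mono_scale[OF g, of "\<alpha> * s" "\<alpha>' * s"] s \<alpha>
      by (meson greaterThanAtMost_iff less_imp_le mult_right_mono subset_trans)
    then show ?thesis
      using th'[OF s w] by blast
  qed
  \<comment> \<open>The bound \<open>\<beta> \<le> 1\<close> is carried along because cells of scale
    \<open>\<beta> * \<alpha> * s\<close> will be enlarged to cells of scale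
    \<open>\<alpha> * s\<close>.\<close>
  have "\<exists>\<beta>>0. \<beta> \<le> 1 \<and> (\<forall>s\<in>{0<..1}. \<forall>w\<in>\<Lambda> g s. \<exists>x\<in>K w. U g M x (\<beta> * s) \<subseteq> K w)"
  proof (induction M)
    case 0
    have "U g 0 x s \<subseteq> U g 1 x s" for x s
      by (rule chain_nbhd_mono_length) simp
    then show ?case
      using th \<alpha> by (meson subset_trans)
  next
    case (Suc M)
    then obtain \<beta> where \<beta>: "0 < \<beta>" "\<beta> \<le> 1"
      and IH: "\<And>s w. s \<in> {0<..1} \<Longrightarrow> w \<in> \<Lambda> g s \<Longrightarrow> \<exists>x\<in>K w. U g M x (\<beta> * s) \<subseteq> K w"
      by blast
    have "\<exists>x\<in>K w. U g (Suc M) x (\<beta> * \<alpha> * s) \<subseteq> K w" if s: "s \<in> {0<..1}" and w: "w \<in> \<Lambda> g s" for s w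
    proof -
      have \<alpha>s: "\<alpha> * s \<in> {0<..1}"
        using s \<alpha> by (simp add: mult_le_one)
      obtain x where x: "x \<in> K w" "U g 1 x (\<alpha> * s) \<subseteq> K w"
        using th[OF s w] by blast
      have wT: "w \<in> T"
        using w scale_iff[OF g] by blast
      obtain v where v: "v \<in> \<Lambda> g (\<alpha> * s)" "x \<in> K v"
        using scale_cover[OF g] \<alpha>s x(1) cell_subset[OF wT] by (meson greaterThanAtMost_iff subsetD)
      obtain x' where x': "x' \<in> K v" "U g M x' (\<beta> * (\<alpha> * s)) \<subseteq> K v"
        using IH[OF \<alpha>s v(1)] by blast
      have vU: "K v \<subseteq> U g 0 x (\<alpha> * s)"
        using v chain_nbhd_0 by blast
      then have "x' \<in> K w"
        using x' x(2) chain_nbhd_mono_length[of 0 1] by blast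
      moreover have "U g (Suc M) x' (\<beta> * \<alpha> * s) \<subseteq> K w"
      proof
        fix y
        assume "y \<in> U g (Suc M) x' (\<beta> * \<alpha> * s)"
        then obtain u where u: "u \<in> \<Lambda> g (\<beta> * \<alpha> * s)" "y \<in> K u"
          "K u \<inter> U g M x' (\<beta> * \<alpha> * s) \<noteq> {}"
          using chain_nbhd_Suc by blast
        have "\<beta> * \<alpha> * s \<le> \<alpha> * s"
          using \<beta> \<alpha>s mult_right_mono[of \<beta> 1 "\<alpha> * s"] by (simp add: mult.assoc)
        then obtain u' where u': "u' \<in> \<Lambda> g (\<alpha> * s)" "K u \<subseteq> K u'"
          using scale_coarsen[OF g u(1)] by blast
        \<comment> \<open>Seen at scale \<open>\<alpha> * s\<close>, the whole chain inside
          \<open>K v\<close> counts as the single cell \<open>v\<close>, and \<open>u'\<close> is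
          the one further step that is allowed from \<open>x\<close>.\<close>
        have "K u' \<inter> U g 0 x (\<alpha> * s) \<noteq> {}"
          using u(3) u'(2) x'(2) vU by (auto simp: mult.assoc)
        then have "y \<in> U g (Suc 0) x (\<alpha> * s)"
          using chain_nbhd_Suc u(2) u' by blast
        then show "y \<in> K w"
          using x(2) by auto
      qed
      ultimately show ?thesis by blast
    qed
    then show ?case
      using \<alpha> \<beta> by (intro exI[of _ "\<beta> * \<alpha>"]) (auto simp: mult_le_one)
  qed
  then show ?thesis by blast
qed


section \<open>Gentleness\<close>

text \<open>Let \<open>w\<close> and \<open>v\<close> meet in one scale of \<open>f\<close>, with
  \<open>h w < h v\<close>. In the scale \<open>h w\<close> of \<open>h\<close> there are a cell
  \<open>w'\<close> above \<open>w\<close> and a cell \<open>v'\<close> below \<open>v\<close> with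
  a common point, so gentleness bounds \<open>f w'\<close> by \<open>f v'\<close>. As
  \<open>f w\<close> and \<open>f v\<close> are comparable, \<open>f v'\<close> is not much smaller
  than \<open>f v\<close>, and \<open>exponential_transfer\<close> turns this into a bound of
  \<open>h v\<close> by \<open>h v' \<le> h w\<close>.\<close>

lemma gentle_sym:
  assumes f: "weight f" "exponential T A \<phi> f" and h: "super_exponential T A \<phi> h"
    and fh: "gentle T A \<phi> K f h"
  shows "gentle T A \<phi> K h f"
proof -
  have wh: "weight h"
    using fh unfolding gentle_def by blast
  obtain c where c: "0 < c"
    and ge: "\<And>s w v. s \<in> {0<..1} \<Longrightarrow> w \<in> \<Lambda> h s \<Longrightarrow> v \<in> \<Lambda> h s \<Longrightarrow> K w \<inter> K v \<noteq> {} \<Longrightarrow> f v \<le> c * f w"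
    using fh unfolding gentle_def by blast
  obtain b where b: "b \<in> {0<..<1}" and lower: "\<forall>s. \<forall>w\<in>\<Lambda> f s. b * min s 1 \<le> f w"
    using scale_lower_bound[OF f(1)] f(2) unfolding exponential_def by blast
  \<comment> \<open>In the ratio \<open>b / c\<close>, the factor \<open>b\<close> compares
    \<open>f w\<close> with \<open>f v\<close> within one scale of \<open>f\<close>, and
    \<open>c\<close> is lost in passing from \<open>w'\<close> to \<open>v'\<close>.\<close>
  obtain \<delta> where \<delta>: "0 < \<delta>" "\<forall>w\<in>T. \<forall>v\<in>sub w. b / c * f w \<le> f v \<longrightarrow> \<delta> * h w \<le> h v"
    using exponential_transfer[of f h "b / c"] f(2) h b c unfolding exponential_def by auto
  have "h v \<le> max 1 (1 / \<delta>) * h w"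
    if s: "s \<in> {0<..1}" and w: "w \<in> \<Lambda> f s" and v: "v \<in> \<Lambda> f s" and meet: "K w \<inter> K v \<noteq> {}" for s w v
  proof (cases "h v \<le> h w")
    case True
    also have "h w \<le> max 1 (1 / \<delta>) * h w"
      using weight_pos[OF wh, of w] w scale_iff[OF f(1)] by simp
    finally show ?thesis .
  next
    case False
    define t where "t = h w"
    have wT: "w \<in> T" and vT: "v \<in> T" and fv: "f v \<le> s"
      using v w scale_iff[OF f(1)] by auto
    have t: "t \<in> {0<..1}"
      using weight_pos[OF wh wT] weight_le_1[OF wh wT] by (simp add: t_def)
    obtain x where x: "x \<in> K w" "x \<in> K v"
      using meet by blast
    obtain w' where w': "w' \<in> \<Lambda> h t" "w \<in> sub w'"
      using scale_ancestor[OF wh wT, of t] t_def by auto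
    \<comment> \<open>Guarantees that the scale \<open>t\<close> is reached at or below
      \<open>v\<close> and not above it.\<close>
    have "t < h (par v)"
      using False weight_parent[OF wh vT] by (simp add: t_def)
    then obtain v' where v': "v' \<in> \<Lambda> h t" "v' \<in> sub v" "x \<in> K v'"
      using scale_descendant[OF wh _ vT x(2), of t] t by auto
    have "x \<in> K w'"
      using x(1) cell_subtree[OF w'(2)] by blast
    then have fw': "f w' \<le> c * f v'"
      using ge[OF t v'(1) w'(1)] v'(3) by blast
    have "b * f v \<le> b * s"
      using fv b by simp
    also have "\<dots> \<le> f w"
      using lower w s by (metis greaterThanAtMost_iff min.absorb1)
    also have "\<dots> \<le> f w'"
      by (rule weight_subtree[OF f(1) w'(2)])
    finally have "b / c * f v \<le> f v'"
      using fw' c by (simp add: field_simps)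
    then have "\<delta> * h v \<le> h v'"
      using \<delta>(2) vT v'(2) by blast
    also have "\<dots> \<le> h w"
      using v'(1) scale_iff[OF wh] by (simp add: t_def)
    finally have "h v \<le> 1 / \<delta> * h w"
      using \<delta>(1) by (simp add: field_simps)
    also have "\<dots> \<le> max 1 (1 / \<delta>) * h w"
      using weight_pos[OF wh wT] by (intro mult_right_mono) auto
    finally show ?thesis .
  qed
  moreover have "0 < max 1 (1 / \<delta>)"
    by simp
  ultimately show ?thesis
    unfolding gentle_def using f(1) weight_pos[OF wh] by blast
qed

text \<open>Each step of a chain moves to one of boundedly many neighbours and costs one gentleness
  constant, so both bounds grow geometrically in \<open>M\<close> but do not depend on the scale or
  the point.\<close>

lemma chain_nbhd_finite_cover:
  assumes g: "uniformly_finite T A \<phi> K g" and h: "gentle T A \<phi> K h g"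
  shows "\<exists>C>0. \<exists>N. \<forall>s\<in>{0<..1}. \<forall>w\<in>\<Lambda> g s. \<forall>x\<in>K w. \<exists>F\<subseteq>\<Lambda> g s. finite F \<and> card F \<le> N \<and>
           U g M x s \<subseteq> (\<Union>v\<in>F. K v) \<and> (\<forall>v\<in>F. h v \<le> C * h w)"
proof -
  obtain c where c: "0 < c"
    and ge: "\<And>s w v. s \<in> {0<..1} \<Longrightarrow> w \<in> \<Lambda> g s \<Longrightarrow> v \<in> \<Lambda> g s \<Longrightarrow> K w \<inter> K v \<noteq> {} \<Longrightarrow> h v \<le> c * h w"
    using h unfolding gentle_def by blast
  define nb where "nb s w = {v \<in> \<Lambda> g s. K v \<inter> K w \<noteq> {}}" for s w
  obtain N where fin: "\<And>s w. s \<in> {0<..1} \<Longrightarrow> w \<in> \<Lambda> g s \<Longrightarrow> finite (nb s w)"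
    and crd: "\<And>s w. s \<in> {0<..1} \<Longrightarrow> w \<in> \<Lambda> g s \<Longrightarrow> card (nb s w) \<le> N"
    using g unfolding uniformly_finite_def nb_def by blast
  show ?thesis
  proof (induction M)
    case 0
    \<comment> \<open>A chain may start in any cell through \<open>x\<close>, not only in
      \<open>w\<close>; such a cell meets \<open>K w\<close>, so the neighbours of \<open>w\<close>
      are needed already at length 0.\<close>
    show ?case
    proof (intro exI[of _ c] conjI exI[of _ N] ballI)
      fix s :: real and w x
      assume s: "s \<in> {0<..1}" and w: "w \<in> \<Lambda> g s" and x: "x \<in> K w"
      have "nb s w \<subseteq> \<Lambda> g s"
        by (auto simp: nb_def)
      moreover have "U g 0 x s \<subseteq> (\<Union>v\<in>nb s w. K v)"
        using x chain_nbhd_0 by (fastforce simp: nb_def)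
      moreover have "\<forall>v\<in>nb s w. h v \<le> c * h w"
        using ge[OF s w] by (auto simp: nb_def)
      ultimately show "\<exists>F\<subseteq>\<Lambda> g s. finite F \<and> card F \<le> N \<and>
           U g 0 x s \<subseteq> (\<Union>v\<in>F. K v) \<and> (\<forall>v\<in>F. h v \<le> c * h w)"
        using fin[OF s w] crd[OF s w] by blast
    qed (rule c)
  next
    case (Suc M)
    then obtain C N' where C: "0 < C"
      and IH: "\<forall>s\<in>{0<..1}. \<forall>w\<in>\<Lambda> g s. \<forall>x\<in>K w. \<exists>F\<subseteq>\<Lambda> g s. finite F \<and> card F \<le> N' \<and>
           U g M x s \<subseteq> (\<Union>v\<in>F. K v) \<and> (\<forall>v\<in>F. h v \<le> C * h w)"
      by (elim exE conjE) (rule that)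
    show ?case
    proof (intro exI[of _ "c * C"] conjI exI[of _ "N' * N"] ballI)
      fix s :: real and w x
      assume s: "s \<in> {0<..1}" and w: "w \<in> \<Lambda> g s" and x: "x \<in> K w"
      obtain F where F: "F \<subseteq> \<Lambda> g s" "finite F" "card F \<le> N'"
        "U g M x s \<subseteq> (\<Union>v\<in>F. K v)" "\<forall>v\<in>F. h v \<le> C * h w"
        using IH[rule_format, OF s w x] by blast
      define G where "G = (\<Union>u\<in>F. nb s u)"
      have "G \<subseteq> \<Lambda> g s"
        by (auto simp: G_def nb_def)
      moreover have "finite G"
        using F fin[OF s] by (auto simp: G_def)
      moreover have "card G \<le> N' * N"
      proof -
        have "card G \<le> (\<Sum>u\<in>F. card (nb s u))"
          unfolding G_def by (rule card_UN_le[OF F(2)])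
        also have "\<dots> \<le> card F * N"
          using crd[OF s] F(1) sum_bounded_above[of F "\<lambda>u. card (nb s u)" N] by auto
        also have "\<dots> \<le> N' * N"
          using F(3) by simp
        finally show ?thesis .
      qed
      moreover have "U g (Suc M) x s \<subseteq> (\<Union>v\<in>G. K v)"
      proof
        fix y
        assume "y \<in> U g (Suc M) x s"
        then obtain v where v: "v \<in> \<Lambda> g s" "y \<in> K v" "K v \<inter> U g M x s \<noteq> {}"
          using chain_nbhd_Suc by blast
        then obtain u where "u \<in> F" "K v \<inter> K u \<noteq> {}"
          using F(4) by blast
        then show "y \<in> (\<Union>v\<in>G. K v)"
          using v by (auto simp: G_def nb_def)
      qed
      moreover have "h v \<le> c * C * h w" if v: "v \<in> G" for v
      proof -
        obtain u where u: "u \<in> F" "v \<in> nb s u"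
          using v by (auto simp: G_def)
        have "h v \<le> c * h u"
          using ge[OF s, of u v] u F(1) by (auto simp: nb_def)
        also have "\<dots> \<le> c * (C * h w)"
          using F(5) u(1) c by simp
        finally show ?thesis by (simp add: mult.assoc)
      qed
      ultimately show "\<exists>F\<subseteq>\<Lambda> g s. finite F \<and> card F \<le> N' * N \<and>
           U g (Suc M) x s \<subseteq> (\<Union>v\<in>F. K v) \<and> (\<forall>v\<in>F. h v \<le> c * C * h w)"
        by blast
    qed (use c C in simp)
  qed
qed

end


section \<open>Metrics and measures\<close>

locale measured_partition = tree_partition T A \<phi> X K + Metric_space "topspace X" d
  for T :: "'t set" and A :: "'t \<Rightarrow> 't \<Rightarrow> nat" and \<phi> :: 't
    and X :: "'x topology" and K :: "'t \<Rightarrow> 'x set" and d :: "'x \<Rightarrow> 'x \<Rightarrow> real" +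
  fixes \<mu> :: "'x measure"
  assumes compact: "compact_space X"
    and mtopology: "mtopology = X"
    and measure: "\<mu> \<in> partition_measures T X K"
begin

abbreviation "gd \<equiv> diam_weight d K"
abbreviation "g\<mu> \<equiv> measure_weight \<mu> K"

section \<open>Borel sets and the weight given by the measure\<close>

lemma prob: "prob_space \<mu>"
  using measure unfolding partition_measures_def radon_probability_def by blast

sublocale prob_space \<mu>
  by (rule prob)

lemma sets_borel: "sets \<mu> = sets (sigma (topspace X) {U. openin X U})"
  using measure unfolding partition_measures_def radon_probability_def by blast

lemma space_eq: "space \<mu> = topspace X"
proof -
  have "space \<mu> = space (sigma (topspace X) {U. openin X U})"
    using sets_borel by (rule sets_eq_imp_space_eq)
  also have "\<dots> = topspace X"
    by (rule space_measure_of) (auto dest: openin_subset)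
  finally show ?thesis .
qed

lemma open_measurable:
  assumes "openin X V"
  shows "V \<in> sets \<mu>"
proof -
  have "{U. openin X U} \<subseteq> Pow (topspace X)"
    by (auto dest: openin_subset)
  then show ?thesis
    unfolding sets_borel using assms by simp
qed

lemma ball_measurable: "mball x r \<in> sets \<mu>"
  by (rule open_measurable) (metis mtopology openin_mball)

lemma cell_measurable:
  assumes "w \<in> T"
  shows "K w \<in> sets \<mu>"
proof -
  have "Hausdorff_space X"
    using Hausdorff_space_mtopology mtopology by simp
  then have "closedin X (K w)"
    using cell_compact[OF assms] compactin_imp_closedin by blast
  then have "openin X (topspace X - K w)" and sub: "K w \<subseteq> topspace X"
    by (auto simp: closedin_def)
  then have "space \<mu> - (topspace X - K w) \<in> sets \<mu>"
    using open_measurable by blast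
  moreover have "space \<mu> - (topspace X - K w) = K w"
    using sub space_eq by auto
  ultimately show ?thesis by simp
qed

text \<open>Gentleness with respect to \<open>g\<mu>\<close> includes that \<open>g\<mu>\<close> is
  a weight function. The suprema over the levels vanish by sub-exponential decay from the
  root.\<close>

lemma measure_weight_weight:
  assumes "sub_exponential T A \<phi> g\<mu>"
  shows "weight g\<mu>"
  unfolding weight_function_def
proof (intro conjI ballI)
  have le1: "g\<mu> w \<le> 1" for w
    unfolding measure_weight_def by (rule prob_le_1)
  have pos: "0 < g\<mu> w" if "w \<in> T" for w
    using assms that unfolding sub_exponential_def by blast
  show "0 < g\<mu> w" if "w \<in> T" for w
    by (rule pos[OF that])
  show "g\<mu> w \<le> 1" for w
    by (rule le1)
  show root: "g\<mu> \<phi> = 1"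
    using prob_space by (simp add: measure_weight_def cell_root space_eq)
  show "g\<mu> w \<le> g\<mu> (par w)" if w: "w \<in> T" for w
  proof (cases "w = \<phi>")
    case False
    then have "par w \<in> T" "K w \<subseteq> K (par w)"
      using parent_in[OF w] child_of_parent[OF w] cell_children by blast+
    then show ?thesis
      unfolding measure_weight_def using cell_measurable by (intro finite_measure_mono) auto
  qed simp
  show "(\<lambda>m. SUP w\<in>level T A \<phi> m. g\<mu> w) \<longlonglongrightarrow> 0"
  proof (rule LIMSEQ_I)
    fix r :: real
    assume "0 < r"
    then have r2: "0 < r / 2" by simp
    obtain n where n: "\<forall>w\<in>T. \<forall>v\<in>sub w. ht w + n \<le> ht v \<longrightarrow> g\<mu> v < r / 2 * g\<mu> w"
      using sub_exponential_decay[OF assms r2] by blast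
    have "norm ((SUP w\<in>level T A \<phi> m. g\<mu> w) - 0) < r" if m: "n \<le> m" for m
    proof -
      \<comment> \<open>The level has to be nonempty, since a real supremum over the empty set
        carries no information.\<close>
      obtain x where "x \<in> K \<phi>"
        using cell_nonempty[OF root_in] by blast
      then obtain v where v: "v \<in> level T A \<phi> m"
        using subtree_cell_height[OF root_in, of x m] subtree_in by (auto simp: level_def)
      have "g\<mu> w \<le> r / 2" if "w \<in> level T A \<phi> m" for w
        using n root_in subtree_root[of w] that m root by (fastforce simp: level_def)
      then have "(SUP w\<in>level T A \<phi> m. g\<mu> w) \<le> r / 2"
        using v by (intro cSUP_least) auto
      moreover have "g\<mu> v \<le> (SUP w\<in>level T A \<phi> m. g\<mu> w)"
        using v le1 by (intro cSUP_upper bdd_aboveI[of _ 1]) auto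
      moreover have "0 < g\<mu> v"
        using v pos by (auto simp: level_def)
      ultimately show ?thesis
        using \<open>0 < r\<close> by simp
    qed
    then show "\<exists>no. \<forall>n\<ge>no. norm ((SUP w\<in>level T A \<phi> n. g\<mu> w) - 0) < r"
      by blast
  qed
qed

text \<open>A real supremum dominates its members only over sets bounded above; compactness provides
  the bound.\<close>

lemma dist_le_diam_weight:
  assumes "w \<in> T" and "x \<in> K w" and "y \<in> K w"
  shows "d x y \<le> gd w"
proof -
  have "mbounded (topspace X)"
    using compact compactin_imp_mbounded by (simp add: compact_space_def mtopology)
  then obtain B where B: "\<And>x y. x \<in> topspace X \<Longrightarrow> y \<in> topspace X \<Longrightarrow> d x y \<le> B"
    unfolding mbounded_alt by blast
  have "bdd_above ((\<lambda>(x, y). d x y) ` (K w \<times> K w))"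
    using B cell_subset[OF assms(1)] by (intro bdd_aboveI[of _ B]) auto
  then have "(\<lambda>(x, y). d x y) (x, y) \<le> (SUP p\<in>K w \<times> K w. (\<lambda>(x, y). d x y) p)"
    using assms by (intro cSUP_upper) auto
  then show ?thesis
    by (simp add: diam_weight_def mdiameter_def)
qed

section \<open>Volume doubling\<close>

lemma volume_doubling_iterate:
  assumes "volume_doubling X d \<mu>"
  shows "\<exists>C>0. \<forall>x\<in>topspace X. \<forall>r>0. measure \<mu> (mball x (2 ^ k * r)) \<le> C * measure \<mu> (mball x r)"
proof (induction k)
  case 0
  show ?case by (intro exI[of _ 1]) simp
next
  case (Suc k)
  then obtain C where C: "0 < C"
    and IH: "\<And>x r. x \<in> topspace X \<Longrightarrow> r > 0 \<Longrightarrow> measure \<mu> (mball x (2 ^ k * r)) \<le> C * measure \<mu> (mball x r)"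
    by blast
  obtain D where D: "0 < D"
    and vd: "\<And>x r. x \<in> topspace X \<Longrightarrow> r > 0 \<Longrightarrow> measure \<mu> (mball x (2 * r)) \<le> D * measure \<mu> (mball x r)"
    using assms unfolding volume_doubling_def by blast
  have "measure \<mu> (mball x (2 ^ Suc k * r)) \<le> D * C * measure \<mu> (mball x r)"
    if x: "x \<in> topspace X" and r: "0 < r" for x r
  proof -
    have "measure \<mu> (mball x (2 * (2 ^ k * r))) \<le> D * measure \<mu> (mball x (2 ^ k * r))"
      using vd[OF x] r by simp
    also have "\<dots> \<le> D * (C * measure \<mu> (mball x r))"
      using IH[OF x r] D by simp
    finally show ?thesis by (simp add: mult.assoc)
  qed
  then show ?case
    using C D by (intro exI[of _ "D * C"]) simp
qed

text \<open>
  By thickness a cell of scale \<open>s\<close> contains a ball of radius comparable to \<open>s\<close>, and a cell meeting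
  it is contained in the concentric ball of radius \<open>3 s\<close>.
\<close>

lemma volume_doubling_imp_gentle:
  assumes ad: "adapted T A \<phi> X K d" and th: "thick T A \<phi> K gd" and vd: "volume_doubling X d \<mu>"
  shows "gentle T A \<phi> K g\<mu> gd"
proof -
  have g: "weight gd"
    using th unfolding thick_def by blast
  have pos: "\<forall>w\<in>T. 0 < g\<mu> w"
    using measure unfolding partition_measures_def measure_weight_def by blast
  obtain M \<alpha>\<^sub>2 where \<alpha>2: "0 < \<alpha>\<^sub>2"
    and ball: "\<And>x r. x \<in> topspace X \<Longrightarrow> r > 0 \<Longrightarrow> mball x r \<subseteq> U gd M x (\<alpha>\<^sub>2 * r)"
    using ad unfolding adapted_def M_adapted_def by blast
  obtain \<alpha> where \<alpha>: "0 < \<alpha>"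
    and thM: "\<And>s w. s \<in> {0<..1} \<Longrightarrow> w \<in> \<Lambda> gd s \<Longrightarrow> \<exists>x\<in>K w. U gd M x (\<alpha> * s) \<subseteq> K w"
    using thick_all_lengths[OF th, of M] by blast
  \<comment> \<open>Chosen so that adaptedness puts the ball of radius \<open>\<beta> * s\<close>
    into the chain neighbourhood of scale \<open>\<alpha> * s\<close>, the one that thickness keeps
    inside \<open>K w\<close>.\<close>
  define \<beta> where "\<beta> = \<alpha> / \<alpha>\<^sub>2"
  have \<beta>: "0 < \<beta>"
    using \<alpha> \<alpha>2 by (simp add: \<beta>_def)
  \<comment> \<open>After \<open>k\<close> doublings the radius \<open>\<beta> * s\<close> exceeds
    \<open>3 * s\<close>. Two meeting cells give \<open>d x y \<le> 2 * s\<close>; the 3 leaves room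
    for the strict inequality of an open ball.\<close>
  obtain k :: nat where "3 / \<beta> < 2 ^ k"
    using real_arch_pow[of 2 "3 / \<beta>"] by auto
  then have k: "3 < 2 ^ k * \<beta>"
    using \<beta> by (simp add: field_simps)
  obtain C where C: "0 < C"
    and vdk: "\<And>x r. x \<in> topspace X \<Longrightarrow> r > 0 \<Longrightarrow> measure \<mu> (mball x (2 ^ k * r)) \<le> C * measure \<mu> (mball x r)"
    using volume_doubling_iterate[OF vd, of k] by blast
  have "g\<mu> v \<le> C * g\<mu> w"
    if s: "s \<in> {0<..1}" and w: "w \<in> \<Lambda> gd s" and v: "v \<in> \<Lambda> gd s" and meet: "K w \<inter> K v \<noteq> {}" for s w v
  proof -
    have wT: "w \<in> T" "gd w \<le> s" and vT: "v \<in> T" "gd v \<le> s"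
      using w v scale_iff[OF g] by blast+
    obtain x where x: "x \<in> K w" "U gd M x (\<alpha> * s) \<subseteq> K w"
      using thM[OF s w] by blast
    have xX: "x \<in> topspace X"
      using x(1) cell_subset[OF wT(1)] by blast
    have "mball x (\<beta> * s) \<subseteq> K w"
    proof -
      have "0 < \<beta> * s" "\<alpha>\<^sub>2 * (\<beta> * s) = \<alpha> * s"
        using \<alpha> \<alpha>2 s by (auto simp: \<beta>_def)
      then show ?thesis
        using ball[OF xX, of "\<beta> * s"] x(2) by (metis subset_trans)
    qed
    moreover have "K v \<subseteq> mball x (2 ^ k * (\<beta> * s))"
    proof
      fix y
      assume y: "y \<in> K v"
      obtain z where z: "z \<in> K w" "z \<in> K v"
        using meet by blast
      have X: "z \<in> topspace X" "y \<in> topspace X"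
        using y z cell_subset vT wT by blast+
      have "d x y \<le> d x z + d z y"
        using triangle xX X by blast
      also have "\<dots> \<le> s + s"
        using dist_le_diam_weight[OF wT(1) x(1) z(1)] dist_le_diam_weight[OF vT(1) z(2) y] wT vT by simp
      also have "\<dots> < 3 * s"
        using s by simp
      also have "\<dots> \<le> 2 ^ k * \<beta> * s"
        using k s by (intro mult_right_mono) auto
      finally show "y \<in> mball x (2 ^ k * (\<beta> * s))"
        using xX X by (simp add: mult.assoc)
    qed
    ultimately have "measure \<mu> (K v) \<le> measure \<mu> (mball x (2 ^ k * (\<beta> * s)))"
      and le: "measure \<mu> (mball x (\<beta> * s)) \<le> measure \<mu> (K w)"
      using ball_measurable cell_measurable wT vT by (auto intro!: finite_measure_mono)
    then have "measure \<mu> (K v) \<le> C * measure \<mu> (mball x (\<beta> * s))"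
      using vdk[OF xX, of "\<beta> * s"] \<beta> s by simp
    also have "\<dots> \<le> C * measure \<mu> (K w)"
      using le C by simp
    finally show ?thesis
      by (simp add: measure_weight_def)
  qed
  then show ?thesis
    unfolding gentle_def using C g pos by blast
qed

text \<open>Both balls are compared with one cell \<open>w\<close> through the centre, taken at the
  scale of the larger ball. The cell inside the smaller ball is chosen among the descendants of
  \<open>w\<close>, so that \<open>exponential_transfer\<close> relates their measures.\<close>

lemma gentle_imp_volume_doubling:
  assumes ad: "adapted T A \<phi> X K d" and uf: "uniformly_finite T A \<phi> K gd"
    and gd: "exponential T A \<phi> gd" and g\<mu>: "super_exponential T A \<phi> g\<mu>"
    and ge: "gentle T A \<phi> K g\<mu> gd"
  shows "volume_doubling X d \<mu>"
proof -
  have g: "weight gd"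
    using uf unfolding uniformly_finite_def by blast
  have pos: "\<And>w. w \<in> T \<Longrightarrow> 0 < g\<mu> w"
    using ge unfolding gentle_def by blast
  obtain M \<alpha>\<^sub>1 \<alpha>\<^sub>2 where \<alpha>1: "0 < \<alpha>\<^sub>1" and \<alpha>2: "0 < \<alpha>\<^sub>2"
    and ball: "\<And>x r. x \<in> topspace X \<Longrightarrow> r > 0 \<Longrightarrow>
      U gd M x (\<alpha>\<^sub>1 * r) \<subseteq> mball x r \<and> mball x r \<subseteq> U gd M x (\<alpha>\<^sub>2 * r)"
    using ad unfolding adapted_def M_adapted_def by blast
  obtain C N where C: "0 < C"
    and cover: "\<forall>s\<in>{0<..1}. \<forall>w\<in>\<Lambda> gd s. \<forall>x\<in>K w. \<exists>F\<subseteq>\<Lambda> gd s. finite F \<and> card F \<le> N \<and>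
           U gd M x s \<subseteq> (\<Union>v\<in>F. K v) \<and> (\<forall>v\<in>F. g\<mu> v \<le> C * g\<mu> w)"
    using chain_nbhd_finite_cover[OF uf ge, of M] by (elim exE conjE) (rule that)
  obtain b where b: "b \<in> {0<..<1}" and lower: "\<forall>s. \<forall>w\<in>\<Lambda> gd s. b * min s 1 \<le> gd w"
    using scale_lower_bound[OF g] gd unfolding exponential_def by blast
  \<comment> \<open>For \<open>s = 2 * \<alpha>\<^sub>2 * r\<close> this yields
    \<open>a * s \<le> \<alpha>\<^sub>1 * r\<close>, so that cells through \<open>x\<close> of scale
    \<open>a * s\<close> lie in the ball of radius \<open>r\<close>; \<open>a \<le> 1\<close> lets
    such a cell be found below \<open>w\<close>.\<close>
  define a where "a = min 1 (\<alpha>\<^sub>1 / (2 * \<alpha>\<^sub>2))"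
  have a: "0 < a" "a \<le> 1" "a * (2 * \<alpha>\<^sub>2) \<le> \<alpha>\<^sub>1"
    using \<alpha>1 \<alpha>2 by (auto simp: a_def min_def field_simps)
  obtain \<delta> where \<delta>: "0 < \<delta>" "\<forall>w\<in>T. \<forall>v\<in>sub w. b * a * gd w \<le> gd v \<longrightarrow> \<delta> * g\<mu> w \<le> g\<mu> v"
    using exponential_transfer[of gd g\<mu> "b * a"] gd g\<mu> a b unfolding exponential_def by auto
  \<comment> \<open>\<open>real N * C\<close> comes from the cover for \<open>s \<le> 1\<close>; the
    1 serves \<open>s > 1\<close>, where \<open>w\<close> is the root and
    \<open>g\<mu> w = 1\<close>.\<close>
  define D where "D = max 1 (real N * C)"
  have D: "1 \<le> D" "real N * C \<le> D"
    by (auto simp: D_def)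
  have "measure \<mu> (mball x (2 * r)) \<le> D / \<delta> * measure \<mu> (mball x r)"
    if x: "x \<in> topspace X" and r: "0 < r" for x r
  proof -
    \<comment> \<open>The scale that adaptedness assigns to the ball of radius
      \<open>2 * r\<close>.\<close>
    define s where "s = 2 * \<alpha>\<^sub>2 * r"
    have s: "0 < s"
      using \<alpha>2 r by (simp add: s_def)
    obtain w where w: "w \<in> \<Lambda> gd s" "x \<in> K w"
      using scale_cover[OF g s x] by blast
    have wT: "w \<in> T" "gd w \<le> s" "w = \<phi> \<or> s < gd (par w)"
      using w(1) scale_iff[OF g] by blast+
    have upper: "measure \<mu> (mball x (2 * r)) \<le> D * g\<mu> w"
    proof (cases "s \<le> 1")
      case True
      then obtain F where F: "F \<subseteq> \<Lambda> gd s" "finite F" "card F \<le> N"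
        "U gd M x s \<subseteq> (\<Union>v\<in>F. K v)" "\<forall>v\<in>F. g\<mu> v \<le> C * g\<mu> w"
        using cover[rule_format, OF _ w] s by auto
      have FT: "F \<subseteq> T"
        using F(1) scale_iff[OF g] by blast
      have "mball x (2 * r) \<subseteq> (\<Union>v\<in>F. K v)"
        using ball[OF x, of "2 * r"] r F(4) by (auto simp: s_def mult_ac)
      then have "measure \<mu> (mball x (2 * r)) \<le> measure \<mu> (\<Union>v\<in>F. K v)"
        using F(2) FT cell_measurable by (intro finite_measure_mono sets.finite_UN) auto
      also have "\<dots> \<le> (\<Sum>v\<in>F. measure \<mu> (K v))"
        using F(2) FT cell_measurable by (intro finite_measure_subadditive_finite) auto
      also have "\<dots> \<le> real (card F) * (C * g\<mu> w)"
        using F(5) by (intro sum_bounded_above) (simp add: measure_weight_def)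
      also have "\<dots> \<le> real N * (C * g\<mu> w)"
        using F(3) C pos[OF wT(1)] by (intro mult_right_mono) auto
      also have "\<dots> \<le> D * g\<mu> w"
        using D(2) pos[OF wT(1)] by (simp flip: mult.assoc)
      finally show ?thesis .
    next
      case False
      then have "w = \<phi>"
        using w(1) by (simp add: scale_def)
      then have "g\<mu> w = 1"
        using prob_space by (simp add: measure_weight_def cell_root space_eq)
      then show ?thesis
        using D(1) order_trans[OF prob_le_1] by simp
    qed
    have as: "0 < a * s" "a * s \<le> s"
      using a s by simp_all
    obtain v where v: "v \<in> \<Lambda> gd (a * s)" "v \<in> sub w" "x \<in> K v"
      using scale_descendant[OF g as(1) wT(1) w(2)] wT(3) as(2) by force
    have "b * a * gd w \<le> b * min (a * s) 1"
    proof -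
      \<comment> \<open>Since \<open>s\<close> may exceed 1, both \<open>gd w \<le> s\<close> and
        \<open>gd w \<le> 1\<close> enter, one for each entry of the minimum.\<close>
      have "a * gd w \<le> min (a * s) 1"
        using a wT weight_le_1[OF g wT(1)] weight_pos[OF g wT(1)] by (auto simp: mult_le_one)
      then show ?thesis
        using b by (simp add: mult.assoc)
    qed
    also have "\<dots> \<le> gd v"
      using lower v(1) by blast
    finally have "\<delta> * g\<mu> w \<le> g\<mu> v"
      using \<delta>(2) wT(1) v(2) by blast
    also have "g\<mu> v \<le> measure \<mu> (mball x r)"
    proof -
      have "K v \<subseteq> U gd 0 x (a * s)"
        using v chain_nbhd_0 by blast
      also have "\<dots> \<subseteq> U gd M x (a * s)"
        by (rule chain_nbhd_mono_length) simp
      also have "a * s \<le> \<alpha>\<^sub>1 * r"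
        using mult_right_mono[OF a(3), of r] r by (simp add: s_def mult_ac)
      then have "U gd M x (a * s) \<subseteq> U gd M x (\<alpha>\<^sub>1 * r)"
        by (rule chain_nbhd_mono_scale[OF g])
      also have "\<dots> \<subseteq> mball x r"
        using ball[OF x r] by blast
      finally show ?thesis
        unfolding measure_weight_def by (rule finite_measure_mono[OF _ ball_measurable])
    qed
    finally have "g\<mu> w \<le> measure \<mu> (mball x r) / \<delta>"
      using \<delta>(1) by (simp add: field_simps)
    then have "D * g\<mu> w \<le> D * (measure \<mu> (mball x r) / \<delta>)"
      using D(1) by (intro mult_left_mono) auto
    then show ?thesis
      using upper by simp
  qed
  moreover have "0 < D / \<delta>"
    using D(1) \<delta>(1) by simp
  ultimately show ?thesis
    unfolding volume_doubling_def by blast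
qed

end

theorem theorem10p4:
  fixes T :: "'t set" and A :: "'t \<Rightarrow> 't \<Rightarrow> nat" and \<phi> :: 't
    and X :: "'x topology" and K :: "'t \<Rightarrow> 'x set"
    and d :: "'x \<Rightarrow> 'x \<Rightarrow> real" and \<mu> :: "'x measure"
  assumes "countable T" and "infinite T"
    and "locally_finite_tree T A" and "\<phi> \<in> T"
    and "compact_space X" and "metrizable_space X"
    and "\<forall>x\<in>topspace X. \<not> openin X {x}"
    and "parametrized_partition T A \<phi> X K"
    and "d \<in> normalized_metrics X"
    and "\<mu> \<in> partition_measures T X K"
    and "adapted T A \<phi> X K d"
    and "thick T A \<phi> K (diam_weight d K)"
    and "exponential T A \<phi> (diam_weight d K)"
    and "uniformly_finite T A \<phi> K (diam_weight d K)"
    and "exponential T A \<phi> (measure_weight \<mu> K)"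
  shows "volume_doubling X d \<mu> \<longleftrightarrow>
         gentle T A \<phi> K (diam_weight d K) (measure_weight \<mu> K)"
proof -
  interpret Metric_space "topspace X" d
    using assms(9) unfolding normalized_metrics_def by blast
  interpret measured_partition T A \<phi> X K d \<mu>
    using assms(3-5,8-10) by unfold_locales (auto simp: normalized_metrics_def)
  have gd: "weight gd"
    using assms(12) unfolding thick_def by blast
  have g\<mu>: "weight g\<mu>" "super_exponential T A \<phi> g\<mu>"
    using assms(15) measure_weight_weight unfolding exponential_def by blast+
  \<comment> \<open>Both weights are exponential, so \<open>gentle_sym\<close> applies in either
    direction.\<close>
  have "gentle T A \<phi> K gd g\<mu> \<longleftrightarrow> gentle T A \<phi> K g\<mu> gd"
    using gentle_sym gd g\<mu> assms(13,15) unfolding exponential_def by blast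
  then show ?thesis
    using volume_doubling_imp_gentle gentle_imp_volume_doubling assms(11-14) g\<mu>(2) by blast
qed

end
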